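(* Let $\mathcal{G}_{n,2}$ denote a uniformly random $2$-regular graph on $n$ vertices. Then asymptotically almost surely $H(\mathcal{G}_{n,2}) \sim \frac{3}{2}\log n$, i.e. $H(\mathcal{G}_{n,2}) = (1+o(1))\frac{3}{2}\log n$ with probability tending to $1$ as $n\to\infty$.
   Context: Hopping forcing: given a graph $G$ with each vertex coloured blue or white, the hopping forcing rule allows a blue vertex $b$ to force (recolour blue) a white vertex $w$ at distance exactly two from $b$, provided that every neighbour of $b$ is blue and $b$ has not previously performed a force (each vertex can perform at most one force during the whole process). A set $B\subseteq V(G)$ is feasible if, starting with exactly the vertices of $B$ blue, repeated (sequential, one force at a time) applications of the rule can make all vertices blue. The hopping forcing number $H(G)$ is the minimum size of a feasible set. $\mathcal{G}_{n,d}$ is the uniform probability space of $d$-regular simple graphs on $n$ labelled vertices ($dn$ even), $d$ fixed and $n\to\infty$. An event holds asymptotically almost surely (a.a.s.) if its probability tends to $1$ as $n\to\infty$; $\log$ is the natural logarithm. *)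

theory Defs
  imports "HOL-Probability.Probability"
begin

text \<open>A simple graph on the vertex set \<open>V\<close> is given by its set \<open>E\<close> of edges,
  each edge being a two-element subset of \<open>V\<close>.\<close>

definition simple_graph :: "'a set \<Rightarrow> 'a set set \<Rightarrow> bool" where
  "simple_graph V E \<longleftrightarrow> (\<forall>e\<in>E. e \<subseteq> V \<and> card e = 2)"

definition nbhd :: "'a set set \<Rightarrow> 'a \<Rightarrow> 'a set" where
  "nbhd E v = {w. {v, w} \<in> E}"

text \<open>The pair \<open>(u, v)\<close> lies in the \<open>k\<close>-th power of the adjacency relation iff there is a walk
  of length \<open>k\<close> from \<open>u\<close> to \<open>v\<close>; the distance is \<open>\<infinity>\<close> between different components.\<close>

definition gdist :: "'a set set \<Rightarrow> 'a \<Rightarrow> 'a \<Rightarrow> enat" where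
  "gdist E u v = (INF k\<in>{k. (u, v) \<in> {(x, y). y \<in> nbhd E x} ^^ k}. enat k)"

text \<open>A state \<open>(B, F)\<close> consists of the set \<open>B\<close> of blue vertices and the set \<open>F\<close> of vertices
  that have already performed their force.\<close>

inductive hop_force :: "'a set \<Rightarrow> 'a set set \<Rightarrow> 'a set \<times> 'a set \<Rightarrow> 'a set \<times> 'a set \<Rightarrow> bool"
  for V :: "'a set" and E :: "'a set set" where
  "\<lbrakk>b \<in> B; b \<notin> F; nbhd E b \<subseteq> B; w \<in> V - B; gdist E b w = 2\<rbrakk>
    \<Longrightarrow> hop_force V E (B, F) (insert w B, insert b F)"

definition feasible :: "'a set \<Rightarrow> 'a set set \<Rightarrow> 'a set \<Rightarrow> bool" where
  "feasible V E B \<longleftrightarrow> B \<subseteq> V \<and> (\<exists>F. (hop_force V E)\<^sup>*\<^sup>* (B, {}) (V, F))"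

text \<open>For finite \<open>V\<close> the minimum exists, because \<open>V\<close> itself is feasible.\<close>

definition hopping_number :: "'a set \<Rightarrow> 'a set set \<Rightarrow> nat" where
  "hopping_number V E = (LEAST k. \<exists>B. feasible V E B \<and> card B = k)"

definition regular_graphs :: "nat \<Rightarrow> nat \<Rightarrow> nat set set set" where
  "regular_graphs n d = {E. simple_graph {..<n} E \<and> (\<forall>v<n. card (nbhd E v) = d)}"

text \<open>When no \<open>d\<close>-regular graph on \<open>n\<close> vertices exists (for \<open>d = 2\<close>: when \<open>n = 1\<close> or \<open>n = 2\<close>),
  this is an unspecified distribution.\<close>

definition random_regular_graph :: "nat \<Rightarrow> nat \<Rightarrow> nat set set pmf" where
  "random_regular_graph n d = pmf_of_set (regular_graphs n d)"

text \<open>The property \<open>P n\<close> holds asymptotically almost surely under the distributions \<open>p n\<close>.\<close>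

definition aas :: "(nat \<Rightarrow> 'a pmf) \<Rightarrow> (nat \<Rightarrow> 'a \<Rightarrow> bool) \<Rightarrow> bool" where
  "aas p P \<longleftrightarrow> (\<lambda>n. measure_pmf.prob (p n) {x. P n x}) \<longlonglongrightarrow> 1"

end

theory Submission
  imports Defs
begin

text \<open>A 2-regular graph is a disjoint union of cycles, and each cycle contributes exactly 3 to the
  hopping number: the first force in a cycle needs a blue vertex with two blue neighbours, and three
  consecutive blue vertices suffice. So \<open>H\<close> is three times the number of cycles.

  Deleting a vertex \<open>v\<close> of a 2-regular graph either removes a triangle or leaves, after joining the
  two neighbours of \<open>v\<close>, a 2-regular graph with the same number of cycles. Hence, weighting each
  graph by \<open>x\<close> to the number of its cycles, the total weight satisfies
  \<open>a n = (n - 1) a (n - 1) + x ((n - 1) choose 2) a (n - 3)\<close>. It follows that \<open>a n / n!\<close> is at most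
  of order \<open>n powr (x / 2 - 1)\<close>, and for \<open>x = 1\<close> at least of that order. The number of cycles thus
  has a probability generating function of order at most \<open>n powr ((x - 1) / 2)\<close>, and the Chernoff
  bound with \<open>x = 1 \<plusminus> \<epsilon>\<close> gives concentration around \<open>ln n / 2\<close>.\<close>

section \<open>Hopping forcing on disjoint cycles\<close>

definition two_regular :: "'a set \<Rightarrow> 'a set set set" where
  "two_regular V = {E. simple_graph V E \<and> (\<forall>v\<in>V. card (nbhd E v) = 2)}"

lemma regular_graphs_2: "regular_graphs n 2 = two_regular {..<n}"
  by (auto simp: regular_graphs_def two_regular_def)

section \<open>Neighbourhoods, distance two, and cycles as vertex lists\<close>

lemma nbhd_sym: "w \<in> nbhd E v \<longleftrightarrow> v \<in> nbhd E w"
  by (simp add: nbhd_def insert_commute)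

lemma nbhd_simple_graph:
  assumes "simple_graph V E" "w \<in> nbhd E v"
  shows "w \<in> V" "v \<in> V" "w \<noteq> v"
  using assms by (force simp: simple_graph_def nbhd_def)+

lemma gdist_eq_2I:
  assumes "u \<in> nbhd E b" "w \<in> nbhd E u" "w \<noteq> b" "w \<notin> nbhd E b"
  shows "gdist E b w = 2"
proof -
  let ?R = "{(x, y). y \<in> nbhd E x}"
  have "(b, w) \<in> ?R ^^ 2"
    using assms by (auto simp: numeral_2_eq_2)
  then have "gdist E b w \<le> enat 2"
    unfolding gdist_def by (intro INF_lower) simp
  moreover have "enat 2 \<le> gdist E b w"
    unfolding gdist_def
  proof (intro INF_greatest)
    fix k assume k: "k \<in> {k. (b, w) \<in> ?R ^^ k}"
    have "k \<noteq> 0" using k assms by (cases k) auto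
    moreover have "k \<noteq> 1" using k assms by auto
    ultimately have "2 \<le> k" by linarith
    then show "enat 2 \<le> enat k" by simp
  qed
  ultimately show ?thesis by (simp add: numeral_eq_enat)
qed

lemma gdist_eq_2D:
  assumes "gdist E b w = 2"
  obtains u where "u \<in> nbhd E b" "w \<in> nbhd E u"
proof -
  let ?R = "{(x, y). y \<in> nbhd E x}"
  let ?A = "enat ` {k. (b, w) \<in> ?R ^^ k}"
  \<comment> \<open>Without any walk the infimum would be \<infinity>; as it is 2, a walk exists and
    the infimum is attained.\<close>
  have "?A \<noteq> {}"
    using assms unfolding gdist_def by (metis Inf_enat_def enat.distinct(1) numeral_eq_enat)
  then have "Inf ?A \<in> ?A"
    unfolding Inf_enat_def by (auto intro: LeastI)
  then have "(b, w) \<in> ?R ^^ 2"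
    using assms by (auto simp: gdist_def numeral_eq_enat)
  then show ?thesis using that by (auto simp: numeral_2_eq_2)
qed

text \<open>The list runs through the vertices in cyclic order, and the index modulo the length
  closes it up. Length at least 3 rules out a single edge traversed back and forth.\<close>

definition is_cycle :: "'a set set \<Rightarrow> 'a list \<Rightarrow> bool" where
  "is_cycle E c \<longleftrightarrow> distinct c \<and> 3 \<le> length c \<and>
     (\<forall>i<length c. {c ! i, c ! (Suc i mod length c)} \<in> E)"

text \<open>Length at least 3 makes the cyclic successor and predecessor distinct, so they account
  for both neighbours. Adding \<open>length c\<close> before subtracting 1 keeps the predecessor
  index right at \<open>i = 0\<close>, where natural subtraction would truncate.\<close>

lemma is_cycle_nbhd:
  assumes E: "E \<in> two_regular V" and c: "is_cycle E c" and V: "set c \<subseteq> V" and i: "i < length c"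
  shows "nbhd E (c ! i) = {c ! (Suc i mod length c), c ! ((i + length c - 1) mod length c)}"
proof -
  let ?m = "length c"
  let ?s = "Suc i mod ?m" and ?p = "(i + ?m - 1) mod ?m"
  have m: "3 \<le> ?m" and d: "distinct c" using c by (auto simp: is_cycle_def)
  have "0 < ?m" using m by linarith
  then have sp: "?s < ?m" "?p < ?m" by simp_all
  have ne: "?s \<noteq> ?p \<and> Suc ?p mod ?m = i"
  proof (cases "i = 0")
    case True
    moreover have "Suc (?m - 1) = ?m" using m by simp
    ultimately show ?thesis using m by simp
  next
    case False
    then have "i + ?m - 1 = (i - 1) + ?m" by simp
    then have "?p = (i - 1) mod ?m" by (metis mod_add_self2)
    also have "(i - 1) mod ?m = i - 1" using i by (intro mod_less) linarith
    finally have p: "?p = i - 1" .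
    moreover have "Suc ?p mod ?m = i" unfolding p using False i by simp
    moreover have "?s \<noteq> i - 1"
    proof (cases "Suc i = ?m")
      case True
      then show ?thesis using m by simp
    qed (use False i in simp)
    ultimately show ?thesis by simp
  qed
  have "{c ! i, c ! ?s} \<in> E" using c i by (simp add: is_cycle_def)
  moreover have "{c ! ?p, c ! (Suc ?p mod ?m)} \<in> E" using c sp(2) unfolding is_cycle_def by blast
  ultimately have "{c ! ?s, c ! ?p} \<subseteq> nbhd E (c ! i)"
    using ne by (auto simp: nbhd_def insert_commute)
  moreover have "card (nbhd E (c ! i)) = 2"
    using E V nth_mem[OF i] by (auto simp: two_regular_def)
  moreover have "card {c ! ?s, c ! ?p} = 2"
    using ne sp d by (simp add: nth_eq_iff_index_eq)
  ultimately show ?thesis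
    by (metis card_subset_eq card.infinite zero_neq_numeral)
qed

lemma is_cycle_closed:
  assumes "E \<in> two_regular V" "is_cycle E c" "set c \<subseteq> V" "x \<in> set c"
  shows "nbhd E x \<subseteq> set c"
proof -
  obtain i where i: "i < length c" "x = c ! i" using assms(4) by (auto simp: in_set_conv_nth)
  then have "length c > 0" by auto
  then show ?thesis using is_cycle_nbhd[OF assms(1-3) i(1)] i by auto
qed

lemma is_cycle_edge:
  assumes "E \<in> two_regular V" "is_cycle E c" "set c \<subseteq> V" "x \<in> set c" "{x, y} \<in> E"
  obtains i where "i < length c" "{x, y} = {c ! i, c ! (Suc i mod length c)}"
proof -
  let ?m = "length c"
  obtain i where i: "i < ?m" "x = c ! i" using assms(4) by (auto simp: in_set_conv_nth)
  have y: "y \<in> nbhd E x" using assms(5) by (simp add: nbhd_def)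
  then consider "y = c ! (Suc i mod ?m)" | "y = c ! ((i + ?m - 1) mod ?m)"
    using is_cycle_nbhd[OF assms(1-3) i(1)] i by auto
  then show ?thesis
  proof cases
    case 1 then show ?thesis using that i by blast
  next
    case 2
    have m: "3 \<le> ?m" using assms(2) by (auto simp: is_cycle_def)
    have "Suc ((i + ?m - 1) mod ?m) mod ?m = i"
      proof -
      have "Suc (i + ?m - 1) = i + ?m" using m by simp
      then show ?thesis using i(1) by (simp add: mod_Suc_eq)
    qed
    moreover have "(i + ?m - 1) mod ?m < ?m" using i(1) by (intro mod_less_divisor) linarith
    ultimately show ?thesis using that[of "(i + ?m - 1) mod ?m"] 2 i(2)
      by (simp add: insert_commute)
  qed
qed

text \<open>Lets a chosen edge be moved to the closing position of the list, where a vertex can be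
  inserted by appending it.\<close>

lemma is_cycle_rotate:
  assumes "is_cycle E c"
  shows "is_cycle E (rotate k c)"
  unfolding is_cycle_def
proof (intro conjI allI impI)
  fix i assume i: "i < length (rotate k c)"
  let ?m = "length c"
  have "0 < ?m" using assms by (auto simp: is_cycle_def)
  then have "rotate k c ! (Suc i mod ?m) = c ! ((k + Suc i mod ?m) mod ?m)"
    by (intro nth_rotate) auto
  also have "(k + Suc i mod ?m) mod ?m = Suc ((k + i) mod ?m) mod ?m"
    by (simp add: mod_simps)
  finally have "rotate k c ! (Suc i mod ?m) = c ! (Suc ((k + i) mod ?m) mod ?m)" .
  moreover have "rotate k c ! i = c ! ((k + i) mod ?m)"
    using i by (intro nth_rotate) auto
  moreover have "(k + i) mod ?m < ?m" using \<open>0 < ?m\<close> by simp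
  ultimately show "{rotate k c ! i, rotate k c ! (Suc i mod length (rotate k c))} \<in> E"
    using assms by (simp add: is_cycle_def)
qed (use assms in \<open>auto simp: is_cycle_def\<close>)

section \<open>Lower and upper bound for a disjoint union of cycles\<close>

definition cycle_cover :: "'a set \<Rightarrow> 'a set set \<Rightarrow> 'a list set \<Rightarrow> bool" where
  "cycle_cover V E C \<longleftrightarrow> finite C \<and> (\<forall>c\<in>C. is_cycle E c) \<and> (\<Union>c\<in>C. set c) = V \<and>
     (\<forall>c\<in>C. \<forall>d\<in>C. c \<noteq> d \<longrightarrow> set c \<inter> set d = {})"

text \<open>Induction backwards from the all-blue state. A force ending outside \<open>C\<close>
  leaves the count alone; a force ending in \<open>C\<close> also starts in \<open>C\<close>, and
  the forcing vertex and its two neighbours were blue before it.\<close>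

lemma hop_force_closed_card:
  assumes E: "E \<in> two_regular V" and C: "C \<subseteq> V" "finite C" "card C \<ge> 3"
    and closed: "\<And>x. x \<in> C \<Longrightarrow> nbhd E x \<subseteq> C"
    and "(hop_force V E)\<^sup>*\<^sup>* (B, F) (V, F')"
  shows "card (B \<inter> C) \<ge> 3"
  using assms(6)
proof (induction "(B, F)" arbitrary: B F rule: converse_rtranclp_induct)
  case base
  then show ?case using C by (simp add: Int_absorb1)
next
  case (step y)
  then obtain B' F1 where y: "y = (B', F1)" by (cases y)
  have IH: "card (B' \<inter> C) \<ge> 3" using step(3)[OF y] .
  from step(1)[unfolded y] obtain b w where bw: "b \<in> B" "nbhd E b \<subseteq> B" "gdist E b w = 2"
      "B' = insert w B"
    by (cases rule: hop_force.cases) auto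
  show ?case
  proof (cases "w \<in> C")
    case False
    then show ?thesis using IH bw by simp
  next
    case True
    from bw(3) obtain u where u: "u \<in> nbhd E b" "w \<in> nbhd E u" by (rule gdist_eq_2D)
    \<comment> \<open>The walk from \<open>b\<close> through \<open>u\<close> to \<open>w\<close> is
      traced back from \<open>w\<close>; closure keeps it inside \<open>C\<close>.\<close>
    have "u \<in> C" using closed[OF True] u(2) nbhd_sym[of w E u] by auto
    then have "b \<in> C" using closed u(1) nbhd_sym[of u E b] by auto
    then have sub: "insert b (nbhd E b) \<subseteq> B \<inter> C" using bw(1,2) closed[of b] by simp
    have "card (nbhd E b) = 2" "b \<notin> nbhd E b"
      using E \<open>b \<in> C\<close> C(1) nbhd_simple_graph(3)[of V E b b] by (auto simp: two_regular_def)
    moreover from this have "finite (nbhd E b)" by (simp add: card_ge_0_finite)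
    ultimately have "card (insert b (nbhd E b)) = 3" by simp
    then show ?thesis using card_mono[OF _ sub] C(2) by simp
  qed
qed

lemma feasible_card_ge:
  assumes E: "E \<in> two_regular V" and C: "cycle_cover V E C" and B: "feasible V E B"
  shows "3 * card C \<le> card B"
proof -
  from B obtain F where BV: "B \<subseteq> V" and F: "(hop_force V E)\<^sup>*\<^sup>* (B, {}) (V, F)"
    by (auto simp: feasible_def)
  have fin: "finite V" using C by (auto simp: cycle_cover_def)
  have 3: "card (B \<inter> set c) \<ge> 3" if c: "c \<in> C" for c
  proof (rule hop_force_closed_card[OF E _ _ _ _ F])
    show V: "set c \<subseteq> V" using C c by (auto simp: cycle_cover_def)
    have cyc: "is_cycle E c" using C c by (auto simp: cycle_cover_def)
    then show "3 \<le> card (set c)" by (simp add: is_cycle_def distinct_card)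
    show "nbhd E x \<subseteq> set c" if "x \<in> set c" for x
      using is_cycle_closed[OF E cyc V that] .
  qed simp
  have "3 * card C = (\<Sum>c\<in>C. 3)" by simp
  also have "\<dots> \<le> (\<Sum>c\<in>C. card (B \<inter> set c))" by (intro sum_mono 3)
  also have "\<dots> = card (\<Union>c\<in>C. B \<inter> set c)"
    by (rule card_UN_disjoint[symmetric]) (use C in \<open>auto simp: cycle_cover_def\<close>)
  also have "\<dots> \<le> card B"
    by (intro card_mono finite_subset[OF BV fin]) auto
  finally show ?thesis .
qed

text \<open>Blue spreads along the list: \<open>c ! (k - 2)\<close>, whose neighbours
  \<open>c ! (k - 3)\<close> and \<open>c ! (k - 1)\<close> are already blue, forces
  \<open>c ! k\<close>. Allowing a larger \<open>B\<close> and a nonempty \<open>F\<close> lets the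
  cycles be treated one after another.\<close>

lemma hop_force_cycle:
  assumes E: "E \<in> two_regular V" and c: "is_cycle E c" and V: "set c \<subseteq> V"
    and B: "set (take 3 c) \<subseteq> B" and F: "F \<inter> set c = {}"
  shows "\<exists>F'\<subseteq>set c. (hop_force V E)\<^sup>*\<^sup>* (B, F) (B \<union> set c, F \<union> F')"
proof -
  have d: "distinct c" and m: "3 \<le> length c" using c by (auto simp: is_cycle_def)
  \<comment> \<open>The bound on \<open>F'\<close> keeps \<open>c ! (k - 2)\<close>, the next
    forcing vertex, among those that have not yet forced.\<close>
  have "\<exists>F'\<subseteq>set (take (k - 2) c). (hop_force V E)\<^sup>*\<^sup>* (B, F) (B \<union> set (take k c), F \<union> F')"
    if "3 \<le> k" "k \<le> length c" for k
    using that
  proof (induction k rule: dec_induct)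
    case base
    have "B \<union> set (take 3 c) = B" using B by blast
    then show ?case by (metis empty_subsetI rtranclp.rtrancl_refl sup_bot.right_neutral)
  next
    case (step k)
    then obtain F' where F': "F' \<subseteq> set (take (k - 2) c)"
      and steps: "(hop_force V E)\<^sup>*\<^sup>* (B, F) (B \<union> set (take k c), F \<union> F')" by auto
    let ?B = "B \<union> set (take k c)" and ?b = "c ! (k - 2)" and ?w = "c ! k"
    have k: "k < length c" "3 \<le> k" using step by auto
    have take_k: "set (take (Suc k) c) = insert ?w (set (take k c))"
      using k by (simp add: take_Suc_conv_app_nth)
    have take_k2: "set (take (Suc k - 2) c) = insert ?b (set (take (k - 2) c))"
      proof -
      have "Suc k - 2 = Suc (k - 2)" using k by simp
      then show ?thesis using k take_Suc_conv_app_nth[of "k - 2" c] by simp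
    qed
    have in_take: "c ! i \<in> set (take j c) \<longleftrightarrow> i < j" if "i < length c" "j \<le> length c" for i j
      using that d by (auto simp: in_set_conv_nth nth_eq_iff_index_eq)
    show ?case
    proof (cases "?w \<in> ?B")
      case True
      then have "B \<union> set (take (Suc k) c) = ?B" using take_k by auto
      then show ?thesis using steps F' take_k2 by (metis subset_insertI2)
    next
      case False
      have nb: "nbhd E ?b = {c ! (k - 1), c ! (k - 3)}"
      proof -
        have "Suc (k - 2) mod length c = k - 1" using k by (simp add: Suc_diff_le)
        moreover have "(k - 2 + length c - 1) mod length c = k - 3"
        proof -
          have "k - 2 + length c - 1 = (k - 3) + length c" using k by simp
          then show ?thesis using k by (metis mod_add_self2 mod_less less_imp_diff_less)
        qed
        ultimately show ?thesis using is_cycle_nbhd[OF E c V, of "k - 2"] k by simp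
      qed
      have nb1: "?w \<in> nbhd E (c ! (k - 1))"
        using is_cycle_nbhd[OF E c V, of "k - 1"] k by simp
      \<comment> \<open>Since \<open>k < length c\<close>, the indices do not wrap round, so
        \<open>?w\<close> is neither \<open>?b\<close> nor one of its two neighbours.\<close>
      have "gdist E ?b ?w = 2"
        by (rule gdist_eq_2I[of "c ! (k - 1)"]) (use nb nb1 k d in \<open>auto simp: nth_eq_iff_index_eq\<close>)
      moreover have "?b \<in> ?B" "nbhd E ?b \<subseteq> ?B" unfolding nb
        using k by (auto simp: in_take)
      moreover have "?b \<notin> F \<union> F'"
      proof -
        have "k - 2 < length c" using k by linarith
        then have "?b \<notin> F'" using F' in_take[of "k - 2" "k - 2"] by auto
        moreover have "?b \<in> set c" using \<open>k - 2 < length c\<close> by simp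
        ultimately show ?thesis using F by auto
      qed
      moreover have "?w \<in> V - ?B" using False V k by auto
      ultimately have "hop_force V E (?B, F \<union> F') (insert ?w ?B, insert ?b (F \<union> F'))"
        by (intro hop_force.intros) auto
      with steps have "(hop_force V E)\<^sup>*\<^sup>* (B, F) (B \<union> set (take (Suc k) c), F \<union> insert ?b F')"
        unfolding take_k by simp
      moreover have "insert ?b F' \<subseteq> set (take (Suc k - 2) c)" using F' take_k2 by auto
      ultimately show ?thesis by blast
    qed
  qed
  from this[of "length c"] m obtain F' where "F' \<subseteq> set (take (length c - 2) c)"
    "(hop_force V E)\<^sup>*\<^sup>* (B, F) (B \<union> set c, F \<union> F')" by auto
  then show ?thesis using set_take_subset[of "length c - 2" c] by blast
qed

text \<open>The cycles are coloured in turn. Every vertex that has forced lies in a finished cycle,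
  so the next cycle still has all its forces available.\<close>

lemma feasible_cycle_cover:
  assumes E: "E \<in> two_regular V" and C: "cycle_cover V E C"
  shows "feasible V E (\<Union>c\<in>C. set (take 3 c))"
proof -
  let ?B = "\<Union>c\<in>C. set (take 3 c)"
  have fin: "finite C" and cyc: "\<And>c. c \<in> C \<Longrightarrow> is_cycle E c" and V: "(\<Union>c\<in>C. set c) = V"
    and disj: "\<And>c d. c \<in> C \<Longrightarrow> d \<in> C \<Longrightarrow> c \<noteq> d \<Longrightarrow> set c \<inter> set d = {}"
    using C by (auto simp: cycle_cover_def)
  have BV: "?B \<subseteq> V" using V by (auto dest: in_set_takeD)
  have "D \<subseteq> C \<longrightarrow> (\<exists>F\<subseteq>(\<Union>c\<in>D. set c).
          (hop_force V E)\<^sup>*\<^sup>* (?B, {}) (?B \<union> (\<Union>c\<in>D. set c), F))" if "finite D" for D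
    using that
  proof (induction D rule: finite_induct)
    case empty
    show ?case by auto
  next
    case (insert c D)
    show ?case
    proof
      assume sub: "insert c D \<subseteq> C"
      then obtain F where F: "F \<subseteq> (\<Union>c\<in>D. set c)"
        and steps: "(hop_force V E)\<^sup>*\<^sup>* (?B, {}) (?B \<union> (\<Union>c\<in>D. set c), F)"
        using insert by auto
      have "F \<inter> set c = {}"
      proof -
        have "set d \<inter> set c = {}" if "d \<in> D" for d
          using disj[of d c] that sub insert by auto
        then show ?thesis using F by blast
      qed
      then obtain F' where "F' \<subseteq> set c" "(hop_force V E)\<^sup>*\<^sup>* (?B \<union> (\<Union>c\<in>D. set c), F)
          ((?B \<union> (\<Union>c\<in>D. set c)) \<union> set c, F \<union> F')"
        using hop_force_cycle[OF E cyc, of c "?B \<union> (\<Union>c\<in>D. set c)" F] sub V by blast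
      then show "\<exists>F\<subseteq>(\<Union>c\<in>insert c D. set c).
          (hop_force V E)\<^sup>*\<^sup>* (?B, {}) (?B \<union> (\<Union>c\<in>insert c D. set c), F)"
        using F rtranclp_trans[OF steps]
        by (intro exI[of _ "F \<union> F'"]) (auto simp: ac_simps)
    qed
  qed
  from this[OF fin] have "\<exists>F. (hop_force V E)\<^sup>*\<^sup>* (?B, {}) (V, F)"
    using V BV by (auto simp: Un_absorb1)
  then show ?thesis using BV by (simp add: feasible_def)
qed

text \<open>Three consecutive vertices per cycle meet the lower bound
  \<open>feasible_card_ge\<close>. From here on the hopping number stands for the number of cycles,
  which therefore does not depend on the cover.\<close>

lemma hopping_number_cycle_cover:
  assumes E: "E \<in> two_regular V" and C: "cycle_cover V E C"
  shows "hopping_number V E = 3 * card C"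
  unfolding hopping_number_def
proof (rule Least_equality)
  let ?B = "\<Union>c\<in>C. set (take 3 c)"
  have 3: "card (set (take 3 c)) = 3" if "c \<in> C" for c
    using C that by (auto simp: cycle_cover_def is_cycle_def distinct_card)
  have "card ?B = (\<Sum>c\<in>C. card (set (take 3 c)))"
    by (rule card_UN_disjoint)
      (use C in \<open>auto simp: cycle_cover_def dest!: in_set_takeD\<close>)
  then have "card ?B = 3 * card C" using 3 by simp
  then show "\<exists>B. feasible V E B \<and> card B = 3 * card C"
    using feasible_cycle_cover[OF E C] by blast
qed (use feasible_card_ge[OF E C] in auto)

section \<open>Deleting a vertex of a 2-regular graph\<close>

lemma doubleton_other:
  assumes "z \<in> {x, y}" "x \<noteq> y"
  obtains w where "z \<noteq> w" "{x, y} = {z, w}"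
  using assms by (metis insertE insert_commute singletonD)

definition spokes :: "'a \<Rightarrow> 'a set \<Rightarrow> 'a set set" where
  "spokes v S = (\<lambda>x. {v, x}) ` S"

lemma nbhd_Un: "nbhd (A \<union> B) x = nbhd A x \<union> nbhd B x"
  by (auto simp: nbhd_def)

lemma nbhd_Diff: "nbhd (A - B) x = nbhd A x - nbhd B x"
  by (auto simp: nbhd_def)

lemma nbhd_edge: "x \<noteq> y \<Longrightarrow> nbhd {{x, y}} z = (if z = x then {y} else if z = y then {x} else {})"
  by (auto simp: nbhd_def doubleton_eq_iff)

lemma nbhd_spokes:
  "v \<notin> S \<Longrightarrow> nbhd (spokes v S) z = (if z = v then S else if z \<in> S then {v} else {})"
  by (auto simp: nbhd_def spokes_def doubleton_eq_iff)

lemma simple_graph_edge: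
  assumes "simple_graph V E" "e \<in> E"
  obtains x y where "e = {x, y}" "x \<noteq> y" "x \<in> V" "y \<in> V"
  using assms unfolding simple_graph_def by (auto simp: card_2_iff)

lemma simple_graph_spokes:
  "v \<notin> S \<Longrightarrow> S \<subseteq> V \<Longrightarrow> v \<in> V \<Longrightarrow> simple_graph V (spokes v S)"
  by (auto simp: simple_graph_def spokes_def card_2_iff)

lemma simple_graph_Un: "simple_graph V A \<Longrightarrow> simple_graph V B \<Longrightarrow> simple_graph V (A \<union> B)"
  by (auto simp: simple_graph_def)

lemma simple_graph_mono: "simple_graph V A \<Longrightarrow> B \<subseteq> A \<Longrightarrow> V \<subseteq> W \<Longrightarrow> simple_graph W B"
  by (auto simp: simple_graph_def)

lemma spokes_nbhd_subset: "spokes v (nbhd E v) \<subseteq> E"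
  by (auto simp: spokes_def nbhd_def)

lemma nbhd_outside: "simple_graph V E \<Longrightarrow> v \<notin> V \<Longrightarrow> nbhd E v = {}"
  using nbhd_simple_graph(2) by fast

lemma spokes_disjoint: "simple_graph V E \<Longrightarrow> v \<notin> V \<Longrightarrow> spokes v S \<inter> E = {}"
  by (auto simp: simple_graph_def spokes_def)

definition subdivide :: "'a \<Rightarrow> 'a set set \<times> 'a set \<Rightarrow> 'a set set" where
  "subdivide v = (\<lambda>(E, e). (E - {e}) \<union> spokes v e)"

text \<open>The edge joining the former neighbours of \<open>v\<close> is returned with the graph,
  so that \<open>subdivide\<close> can undo the operation.\<close>

definition suppress :: "'a \<Rightarrow> 'a set set \<Rightarrow> 'a set set \<times> 'a set" where
  "suppress v E = ((E - spokes v (nbhd E v)) \<union> {nbhd E v}, nbhd E v)"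

text \<open>\<open>S\<close> holds the other two corners of the triangle;
  \<open>remove_triangle\<close> returns it, so that the two operations invert each other.\<close>

definition add_triangle :: "'a \<Rightarrow> 'a set \<times> 'a set set \<Rightarrow> 'a set set" where
  "add_triangle v = (\<lambda>(S, E). E \<union> ({S} \<union> spokes v S))"

definition remove_triangle :: "'a \<Rightarrow> 'a set set \<Rightarrow> 'a set \<times> 'a set set" where
  "remove_triangle v E = (nbhd E v, E - ({nbhd E v} \<union> spokes v (nbhd E v)))"

section \<open>The operations preserve 2-regularity and are mutually inverse\<close>

lemma two_regular_nbhd:
  assumes "E \<in> two_regular V" "v \<in> V"
  obtains x y where "nbhd E v = {x, y}" "x \<noteq> y" "x \<noteq> v" "y \<noteq> v" "x \<in> V" "y \<in> V"
proof -
  have "simple_graph V E" "card (nbhd E v) = 2" using assms by (auto simp: two_regular_def)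
  then show ?thesis using that nbhd_simple_graph[of V E _ v]
    by (metis card_2_iff insertI1 insertI2)
qed

text \<open>Each end of \<open>e\<close> trades the other end for \<open>v\<close>, so degrees are
  kept. The second conclusion lets \<open>e\<close> be read off again from the new graph.\<close>

lemma two_regular_subdivide:
  assumes E: "E \<in> two_regular V" and e: "e \<in> E" and v: "v \<notin> V"
  shows "subdivide v (E, e) \<in> two_regular (insert v V)" "nbhd (subdivide v (E, e)) v = e"
proof -
  have sg: "simple_graph V E" using E by (simp add: two_regular_def)
  then obtain x y where xy: "e = {x, y}" "x \<noteq> y" "x \<in> V" "y \<in> V"
    using e by (rule simple_graph_edge)
  have vxy: "v \<noteq> x" "v \<noteq> y" using xy v by auto
  have nb: "nbhd (subdivide v (E, e)) z = (nbhd E z - nbhd {e} z) \<union> nbhd (spokes v e) z" for z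
    by (simp add: subdivide_def nbhd_Un nbhd_Diff)
  show nbv: "nbhd (subdivide v (E, e)) v = e"
    unfolding nb using vxy xy by (simp add: nbhd_outside[OF sg v] nbhd_spokes)
  have "simple_graph (insert v V) (subdivide v (E, e))"
    unfolding subdivide_def prod.case
    using sg vxy xy by (intro simple_graph_Un simple_graph_spokes) (auto intro: simple_graph_mono)
  moreover have "card (nbhd (subdivide v (E, e)) z) = 2" if z: "z \<in> insert v V" for z
  proof (cases "z = v")
    case True
    then show ?thesis using nbv xy by simp
  next
    case False
    then have c: "card (nbhd E z) = 2" using E z by (simp add: two_regular_def)
    then have fin: "finite (nbhd E z)" by (metis card.infinite zero_neq_numeral)
    have vn: "v \<notin> nbhd E z" using nbhd_simple_graph(1)[OF sg] v by blast
    show ?thesis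
    proof (cases "z \<in> e")
      case True
      then obtain w where w: "z \<noteq> w" "e = {z, w}" using doubleton_other[of z x y] xy by auto
      have "z \<noteq> v" "w \<noteq> v" using vxy xy(1) w(2) by auto
      then have "nbhd (subdivide v (E, e)) z = insert v (nbhd E z - {w})"
        unfolding nb unfolding w(2) using w(1) by (simp add: nbhd_edge nbhd_spokes)
      moreover have "w \<in> nbhd E z" using e w by (simp add: nbhd_def)
      ultimately show ?thesis using vn fin c by simp
    next
      case z: False
      then show ?thesis unfolding nb using xy vxy False c by (simp add: nbhd_edge nbhd_spokes)
    qed
  qed
  ultimately show "subdivide v (E, e) \<in> two_regular (insert v V)" by (simp add: two_regular_def)
qed

lemma suppress_subdivide:
  assumes E: "E \<in> two_regular V" and e: "e \<in> E" and v: "v \<notin> V"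
  shows "suppress v (subdivide v (E, e)) = (E, e)"
proof -
  have "simple_graph V E" using E by (simp add: two_regular_def)
  then have "spokes v e \<inter> E = {}" using v by (rule spokes_disjoint)
  then show ?thesis using e
    unfolding suppress_def two_regular_subdivide(2)[OF assms] by (auto simp: subdivide_def)
qed

text \<open>The edge \<open>e\<close> between the neighbours of \<open>v\<close> has been removed,
  so \<open>v\<close> is on no triangle. This puts subdivisions into one class of the case split in
  the count.\<close>

lemma nbhd_subdivide_notin:
  assumes "E \<in> two_regular V" "e \<in> E" "v \<notin> V"
  shows "nbhd (subdivide v (E, e)) v \<notin> subdivide v (E, e)"
proof -
  have "e \<subseteq> V" using assms by (auto simp: two_regular_def simple_graph_def)
  then have "e \<notin> spokes v e" using assms by (auto simp: spokes_def)
  then show ?thesis unfolding two_regular_subdivide(2)[OF assms] by (simp add: subdivide_def)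
qed

text \<open>As the neighbours of \<open>v\<close> are not adjacent, the edge added between them is
  new: each trades \<open>v\<close> for the other, and the degrees stay 2.\<close>

lemma two_regular_suppress:
  assumes E: "E \<in> two_regular V" and v: "v \<in> V" and ne: "nbhd E v \<notin> E"
  shows "fst (suppress v E) \<in> two_regular (V - {v})" "snd (suppress v E) \<in> fst (suppress v E)"
    "subdivide v (suppress v E) = E"
proof -
  have sg: "simple_graph V E" using E by (simp add: two_regular_def)
  obtain x y where xy: "nbhd E v = {x, y}" "x \<noteq> y" "x \<noteq> v" "y \<noteq> v" "x \<in> V" "y \<in> V"
    using two_regular_nbhd[OF E v] .
  let ?E = "fst (suppress v E)"
  have nb: "nbhd ?E z = (nbhd E z - nbhd (spokes v {x, y}) z) \<union> nbhd {{x, y}} z" for z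
    by (simp only: suppress_def xy(1) nbhd_Un nbhd_Diff fst_conv)
  show "snd (suppress v E) \<in> ?E" by (simp add: suppress_def)
  show "subdivide v (suppress v E) = E"
  proof -
    have "spokes v {x, y} \<subseteq> E" "{x, y} \<notin> E"
      using spokes_nbhd_subset[of v E] ne unfolding xy(1) .
    then show ?thesis unfolding suppress_def subdivide_def prod.case xy(1) by blast
  qed
  have "simple_graph (V - {v}) ?E"
    unfolding simple_graph_def
  proof
    fix f assume f: "f \<in> ?E"
    show "f \<subseteq> V - {v} \<and> card f = 2"
    proof (cases "f = {x, y}")
      case True
      then show ?thesis using xy by auto
    next
      case False
      then have f: "f \<in> E" "f \<notin> spokes v (nbhd E v)" using f xy by (auto simp: suppress_def)
      obtain a b where ab: "f = {a, b}" "a \<noteq> b" "a \<in> V" "b \<in> V"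
        using sg f(1) by (rule simple_graph_edge)
      then have "v \<notin> f" using f by (auto simp: spokes_def nbhd_def insert_commute)
      then show ?thesis using ab by auto
    qed
  qed
  moreover have "card (nbhd ?E z) = 2" if z: "z \<in> V - {v}" for z
  proof -
    have c: "card (nbhd E z) = 2" using E z by (simp add: two_regular_def)
    then have fin: "finite (nbhd E z)" by (metis card.infinite zero_neq_numeral)
    show ?thesis
    proof (cases "z \<in> {x, y}")
      case True
      then obtain w where w: "z \<noteq> w" "{x, y} = {z, w}" using xy(2) by (rule doubleton_other)
      have wn: "w \<notin> nbhd E z" using ne unfolding xy(1) w(2) by (simp add: nbhd_def)
      have vn: "v \<in> nbhd E z" using True xy(1) nbhd_sym[of z E v] by simp
      have "z \<noteq> v" using z by simp
      moreover have "w \<noteq> v" using w(2) xy(3,4) by auto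
      ultimately have "nbhd ?E z = insert w (nbhd E z - {v})"
        unfolding nb unfolding w(2) using w(1) by (simp add: nbhd_edge nbhd_spokes)
      then show ?thesis using fin c wn vn by simp
    next
      case False
      then show ?thesis unfolding nb using xy z c by (simp add: nbhd_edge nbhd_spokes)
    qed
  qed
  ultimately show "?E \<in> two_regular (V - {v})" by (simp add: two_regular_def)
qed

lemma two_regular_add_triangle:
  assumes E: "E \<in> two_regular V" and v: "v \<notin> V" "v \<notin> S" and S: "card S = 2" "S \<inter> V = {}"
  shows "add_triangle v (S, E) \<in> two_regular (insert v (S \<union> V))"
    "nbhd (add_triangle v (S, E)) v = S"
    "nbhd (add_triangle v (S, E)) v \<in> add_triangle v (S, E)"
    "remove_triangle v (add_triangle v (S, E)) = (S, E)"
proof -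
  have sg: "simple_graph V E" using E by (simp add: two_regular_def)
  obtain x y where xy: "S = {x, y}" "x \<noteq> y" using S by (auto simp: card_2_iff)
  let ?E = "add_triangle v (S, E)"
  have nb: "nbhd ?E z = nbhd E z \<union> (nbhd {S} z \<union> nbhd (spokes v S) z)" for z
    by (simp only: add_triangle_def prod.case nbhd_Un)
  show nbv: "nbhd ?E v = S"
    unfolding nb using v xy by (simp add: nbhd_outside[OF sg] nbhd_spokes nbhd_edge)
  then show "nbhd ?E v \<in> ?E" by (simp add: add_triangle_def)
  have "S \<notin> E" using sg S xy by (auto simp: simple_graph_def)
  then show "remove_triangle v ?E = (S, E)"
    using spokes_disjoint[OF sg v(1), of S] unfolding remove_triangle_def nbv
    by (auto simp: add_triangle_def)
  have "simple_graph (insert v (S \<union> V)) ?E"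
    unfolding add_triangle_def prod.case
    using sg v S by (intro simple_graph_Un simple_graph_spokes)
      (auto intro: simple_graph_mono simp: simple_graph_def)
  moreover have "card (nbhd ?E z) = 2" if z: "z \<in> insert v (S \<union> V)" for z
  proof -
    consider "z = v" | "z \<in> S" | "z \<in> V" "z \<noteq> v" "z \<notin> S" using z by blast
    then show ?thesis
    proof cases
      case 1
      then show ?thesis using nbv S by simp
    next
      case 2
      then obtain w where w: "z \<noteq> w" "S = {z, w}" using doubleton_other[of z x y] xy by auto
      have "nbhd E z = {}" using S(2) 2 by (intro nbhd_outside[OF sg]) auto
      then show ?thesis unfolding nb unfolding w(2) using w v by (auto simp: nbhd_edge nbhd_spokes)
    next
      case 3
      then show ?thesis unfolding nb using xy v E
        by (simp add: nbhd_edge nbhd_spokes two_regular_def)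
    qed
  qed
  ultimately show "?E \<in> two_regular (insert v (S \<union> V))" by (simp add: two_regular_def)
qed

text \<open>Each corner has its degree used up by the other two, so the triangle is a whole
  component and its removal leaves all other degrees alone.\<close>

lemma two_regular_remove_triangle:
  assumes E: "E \<in> two_regular V" and v: "v \<in> V" and tri: "nbhd E v \<in> E"
  shows "snd (remove_triangle v E) \<in> two_regular (V - {v} - nbhd E v)"
    "add_triangle v (remove_triangle v E) = E"
proof -
  have sg: "simple_graph V E" using E by (simp add: two_regular_def)
  obtain x y where xy: "nbhd E v = {x, y}" "x \<noteq> y" "x \<noteq> v" "y \<noteq> v" "x \<in> V" "y \<in> V"
    using two_regular_nbhd[OF E v] .
  let ?E = "snd (remove_triangle v E)"
  have nb: "nbhd ?E z = nbhd E z - (nbhd {{x, y}} z \<union> nbhd (spokes v {x, y}) z)" for z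
    by (simp only: remove_triangle_def xy(1) nbhd_Un nbhd_Diff snd_conv)
  show "add_triangle v (remove_triangle v E) = E"
    using spokes_nbhd_subset[of v E] tri by (auto simp: remove_triangle_def add_triangle_def)
  have c: "card (nbhd E z) = 2" if "z \<in> V" for z
    using E that by (simp add: two_regular_def)
  have empty: "nbhd ?E z = {}" if z: "z \<in> {v, x, y}" for z
  proof (cases "z = v")
    case True
    then show ?thesis unfolding nb using xy by (simp add: nbhd_spokes)
  next
    case False
    then obtain w where w: "z \<noteq> w" "{x, y} = {z, w}" using xy z doubleton_other[of z x y] by auto
    have "w \<noteq> v" using w xy by (metis doubleton_eq_iff)
    have "{v, w} \<subseteq> nbhd E z"
      using w tri xy nbhd_sym[of z E v] by (auto simp: nbhd_def)
    moreover have "card {v, w} = 2" using \<open>w \<noteq> v\<close> by simp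
    ultimately have "nbhd E z = {v, w}"
      using c[of z] z v xy by (metis card_subset_eq card.infinite zero_neq_numeral empty_iff insert_iff)
    then show ?thesis unfolding nb w(2) using False w(1) \<open>w \<noteq> v\<close>
      by (simp add: nbhd_edge nbhd_spokes)
  qed
  have "simple_graph (V - {v} - {x, y}) ?E"
    unfolding simple_graph_def
  proof
    fix f assume f: "f \<in> ?E"
    then have "f \<in> E" by (simp add: remove_triangle_def)
    with sg obtain a b where ab: "f = {a, b}" "a \<noteq> b" "a \<in> V" "b \<in> V"
      by (rule simple_graph_edge)
    then have "b \<in> nbhd ?E a" "a \<in> nbhd ?E b" using f by (auto simp: nbhd_def insert_commute)
    then have "a \<notin> {v, x, y}" "b \<notin> {v, x, y}" using empty by blast+
    then show "f \<subseteq> V - {v} - {x, y} \<and> card f = 2" using ab by auto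
  qed
  moreover have "card (nbhd ?E z) = 2" if z: "z \<in> V - {v} - {x, y}" for z
    unfolding nb using xy z c by (simp add: nbhd_edge nbhd_spokes)
  ultimately show "?E \<in> two_regular (V - {v} - nbhd E v)" using xy by (simp add: two_regular_def)
qed

text \<open>Double counting of incidences. It gives the number of edges available for subdivision,
  hence the first coefficient of the recurrence.\<close>

lemma card_two_regular_edges:
  assumes "E \<in> two_regular V" "finite V"
  shows "card E = card V"
proof -
  have sg: "simple_graph V E" using assms by (simp add: two_regular_def)
  then have fin: "finite E"
    using assms(2) by (intro finite_subset[of E "Pow V"]) (auto simp: simple_graph_def)
  have "card {e \<in> E. v \<in> e} = 2" if v: "v \<in> V" for v
  proof -
    have "{e \<in> E. v \<in> e} = (\<lambda>w. {v, w}) ` nbhd E v"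
    proof (intro equalityI subsetI)
      fix e assume e: "e \<in> {e \<in> E. v \<in> e}"
      then obtain x y where "e = {x, y}" using sg by (auto elim: simple_graph_edge)
      then show "e \<in> (\<lambda>w. {v, w}) ` nbhd E v"
        using e by (auto simp: nbhd_def insert_commute)
    qed (auto simp: nbhd_def)
    also have "card \<dots> = card (nbhd E v)"
      by (intro card_image inj_onI) (auto simp: doubleton_eq_iff)
    finally show ?thesis using assms v by (simp add: two_regular_def)
  qed
  then have "(\<Sum>v\<in>V. card {e \<in> E. v \<in> e}) = 2 * card V" by simp
  moreover have "(\<Sum>v\<in>V. card {e \<in> E. v \<in> e}) = 2 * card E"
  proof (rule sum_multicount[OF assms(2) fin], intro ballI)
    fix e assume "e \<in> E"
    then have "{v \<in> V. v \<in> e} = e" "card e = 2" using sg by (auto simp: simple_graph_def)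
    then show "card {v \<in> V. v \<in> e} = 2" by simp
  qed
  ultimately show ?thesis by simp
qed

section \<open>Cycle covers under the two operations\<close>

lemma is_cycle_mono:
  assumes "is_cycle E c" "\<And>i. i < length c \<Longrightarrow> {c ! i, c ! (Suc i mod length c)} \<in> E'"
  shows "is_cycle E' c"
  using assms by (simp add: is_cycle_def)

text \<open>The cycle through \<open>e\<close> is rotated until \<open>e\<close> is its closing
  edge; appending \<open>v\<close> then lengthens that cycle, and the other cycles are
  untouched.\<close>

lemma cycle_cover_subdivide:
  assumes E: "E \<in> two_regular V" and e: "e \<in> E" and v: "v \<notin> V" and C: "cycle_cover V E C"
  shows "\<exists>C'. cycle_cover (insert v V) (subdivide v (E, e)) C' \<and> card C' = card C"
proof -
  have sg: "simple_graph V E" using E by (simp add: two_regular_def)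
  then obtain x y where xy: "e = {x, y}" "x \<noteq> y" "x \<in> V" "y \<in> V"
    using e by (rule simple_graph_edge)
  have fin: "finite C" and cyc: "\<And>c. c \<in> C \<Longrightarrow> is_cycle E c" and V: "(\<Union>c\<in>C. set c) = V"
    and disj: "\<And>c d. c \<in> C \<Longrightarrow> d \<in> C \<Longrightarrow> c \<noteq> d \<Longrightarrow> set c \<inter> set d = {}"
    using C by (auto simp: cycle_cover_def)
  obtain c0 where c0: "c0 \<in> C" "x \<in> set c0" using xy V by auto
  then obtain i where i: "i < length c0" "e = {c0 ! i, c0 ! (Suc i mod length c0)}"
    using is_cycle_edge[OF E cyc[OF c0(1)], of x y] e V xy(1) by blast
  \<comment> \<open>Rotation by \<open>Suc i\<close> puts \<open>c0 ! i\<close> last and its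
    successor first.\<close>
  define c where "c = rotate (Suc i) c0"
  let ?m = "length c"
  have c: "is_cycle E c" unfolding c_def using cyc c0 by (intro is_cycle_rotate)
  have m: "3 \<le> ?m" and d: "distinct c" using c by (auto simp: is_cycle_def)
  have c_c0: "set c = set c0" by (simp add: c_def)
  have e_c: "e = {c ! (?m - 1), c ! 0}"
  proof -
    have "c ! 0 = c0 ! (Suc i mod length c0)"
      using i unfolding c_def by (subst nth_rotate) auto
    moreover have "c ! (?m - 1) = c0 ! ((Suc i + (length c0 - 1)) mod length c0)"
      using i unfolding c_def by (subst nth_rotate) auto
    moreover have "(Suc i + (length c0 - 1)) mod length c0 = i"
    proof -
      have "Suc i + (length c0 - 1) = i + length c0" using i by linarith
      then show ?thesis using i by simp
    qed
    ultimately show ?thesis using i by (simp add: insert_commute)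
  qed
  let ?E = "subdivide v (E, e)"
  have new: "is_cycle ?E (c @ [v])"
    unfolding is_cycle_def
  proof (intro conjI allI impI)
    show "distinct (c @ [v])" using d v c_c0 c0 V by auto
    show "3 \<le> length (c @ [v])" using m by simp
    fix j assume "j < length (c @ [v])"
    then consider "Suc j < ?m" | "Suc j = ?m" | "j = ?m" by fastforce
    then show "{(c @ [v]) ! j, (c @ [v]) ! (Suc j mod length (c @ [v]))} \<in> ?E"
    proof cases
      case 1
      then have "{c ! j, c ! Suc j} \<in> E" using c by (auto simp: is_cycle_def dest: spec[of _ j])
      moreover have "{c ! j, c ! Suc j} \<noteq> e"
      proof -
        \<comment> \<open>An edge between consecutive list entries could equal the closing edge only
          for \<open>j = 0\<close> and \<open>Suc j = ?m - 1\<close>, which would mean length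
          2.\<close>
        have "j < ?m" "0 < ?m" "?m - 1 < ?m" "j \<noteq> ?m - 1" "j \<noteq> 0 \<or> Suc j \<noteq> ?m - 1"
          using 1 m by linarith+
        then show ?thesis
          unfolding e_c using 1 d by (simp add: doubleton_eq_iff nth_eq_iff_index_eq)
      qed
      ultimately show ?thesis using 1 by (simp add: subdivide_def nth_append)
    next
      case 2
      then have "j = ?m - 1" by simp
      moreover have "c ! (?m - 1) \<in> e" using e_c by simp
      ultimately show ?thesis using 2
        by (auto simp: subdivide_def spokes_def nth_append insert_commute)
    next
      case 3
      have "c ! 0 \<in> e" using e_c by simp
      then show ?thesis using 3 m by (auto simp: subdivide_def spokes_def nth_append)
    qed
  qed
  have old: "is_cycle ?E a" if a: "a \<in> C - {c0}" for a
  proof (rule is_cycle_mono[OF cyc])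
    fix j assume j: "j < length a"
    \<comment> \<open>Another cycle avoids the end \<open>x\<close> of \<open>e\<close>, so none of
      its edges is the removed one.\<close>
    have "x \<notin> set a" using disj[of a c0] a c0 by auto
    then have "{a ! j, a ! (Suc j mod length a)} \<noteq> e"
    proof -
      have "0 < length a" using j by linarith
      then have "a ! j \<in> set a" "a ! (Suc j mod length a) \<in> set a" using j by simp_all
      then show ?thesis using \<open>x \<notin> set a\<close> xy by auto
    qed
    then show "{a ! j, a ! (Suc j mod length a)} \<in> ?E"
      using cyc[of a] a j by (simp add: is_cycle_def subdivide_def)
  qed (use a in auto)
  have "c @ [v] \<notin> C - {c0}" using V v by force
  then have "card (insert (c @ [v]) (C - {c0})) = card C"
    using fin c0(1) card_Suc_Diff1[OF fin c0(1)] by simp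
  moreover have "cycle_cover (insert v V) ?E (insert (c @ [v]) (C - {c0}))"
    unfolding cycle_cover_def
  proof (intro conjI)
    show "(\<Union>c\<in>insert (c @ [v]) (C - {c0}). set c) = insert v V"
    proof -
      have "C = insert c0 (C - {c0})" using c0 by auto
      then have "(\<Union>c\<in>C. set c) = set c0 \<union> (\<Union>c\<in>C - {c0}. set c)" by (metis UN_insert)
      then show ?thesis unfolding V by (simp add: c_c0)
    qed
    have D: "set (c @ [v]) \<inter> set a = {}" if a: "a \<in> C - {c0}" for a
    proof -
      have "set c \<inter> set a = {}" using disj[of c0 a] c0(1) a c_c0 by auto
      moreover have "v \<notin> set a" using a v V by blast
      ultimately show ?thesis by simp
    qed
    show "\<forall>a\<in>insert (c @ [v]) (C - {c0}). \<forall>b\<in>insert (c @ [v]) (C - {c0}).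
        a \<noteq> b \<longrightarrow> set a \<inter> set b = {}"
    proof (intro ballI impI)
      fix a b assume "a \<in> insert (c @ [v]) (C - {c0})" "b \<in> insert (c @ [v]) (C - {c0})" "a \<noteq> b"
      then consider "a = c @ [v]" "b \<in> C - {c0}" | "b = c @ [v]" "a \<in> C - {c0}"
        | "a \<in> C" "b \<in> C" "a \<noteq> b" by blast
      then show "set a \<inter> set b = {}"
      proof cases
        case 1
        then show ?thesis using D by simp
      next
        case 2
        then show ?thesis using D[of a] by (simp only: Int_commute)
      next
        case 3
        then show ?thesis by (rule disj)
      qed
    qed
  qed (use fin new old in auto)
  ultimately show ?thesis by blast
qed

lemma cycle_cover_add_triangle:
  assumes E: "E \<in> two_regular V" and v: "v \<notin> V" "v \<notin> S" and S: "card S = 2" "S \<inter> V = {}"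
    and C: "cycle_cover V E C"
  shows "\<exists>C'. cycle_cover (insert v (S \<union> V)) (add_triangle v (S, E)) C' \<and> card C' = Suc (card C)"
proof -
  obtain x y where xy: "S = {x, y}" "x \<noteq> y" using S by (auto simp: card_2_iff)
  let ?c = "[v, x, y]"
  let ?E = "add_triangle v (S, E)"
  have fin: "finite C" and cyc: "\<And>c. c \<in> C \<Longrightarrow> is_cycle E c" and V: "(\<Union>c\<in>C. set c) = V"
    and disj: "\<And>c d. c \<in> C \<Longrightarrow> d \<in> C \<Longrightarrow> c \<noteq> d \<Longrightarrow> set c \<inter> set d = {}"
    using C by (auto simp: cycle_cover_def)
  have "is_cycle ?E ?c"
    unfolding is_cycle_def
  proof (intro conjI allI impI)
    show "distinct ?c" using xy v by auto
    have edges: "{v, x} \<in> ?E" "{x, y} \<in> ?E" "{y, v} \<in> ?E"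
      using xy(1) by (auto simp: add_triangle_def spokes_def insert_commute)
    fix i assume "i < length ?c"
    then consider "i = 0" | "i = 1" | "i = 2" by fastforce
    then show "{?c ! i, ?c ! (Suc i mod length ?c)} \<in> ?E" by cases (simp_all add: edges)
  qed simp
  moreover have "is_cycle ?E c" if "c \<in> C" for c
    using cyc[OF that] by (rule is_cycle_mono) (use cyc[OF that] in \<open>auto simp: is_cycle_def add_triangle_def\<close>)
  moreover have d: "set ?c \<inter> set c = {}" if "c \<in> C" for c
    using that V v S xy by auto
  moreover have "?c \<notin> C" using d by force
  ultimately have "cycle_cover (insert v (S \<union> V)) ?E (insert ?c C)" "card (insert ?c C) = Suc (card C)"
    unfolding cycle_cover_def using fin disj V xy by (auto simp: disjoint_iff)
  then show ?thesis by blast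
qed

text \<open>Strong induction on the number of vertices: any vertex is deleted, and a cover of the
  smaller graph is extended by one of the two operations. No walk along the graph has to be
  followed.\<close>

lemma ex_cycle_cover:
  assumes "finite V" "E \<in> two_regular V"
  shows "\<exists>C. cycle_cover V E C"
  using assms
proof (induction "card V" arbitrary: V E rule: less_induct)
  case less
  show ?case
  proof (cases "V = {}")
    case True
    then have "cycle_cover V E {}" by (simp add: cycle_cover_def)
    then show ?thesis by blast
  next
    case False
    then obtain v where v: "v \<in> V" by blast
    show ?thesis
    proof (cases "nbhd E v \<in> E")
      case True
      note R = two_regular_remove_triangle[OF less.prems(2) v True]
      have c: "card (nbhd E v) = 2" using less.prems v by (simp add: two_regular_def)
      have sub: "nbhd E v \<subseteq> V - {v}"
        using less.prems nbhd_simple_graph[of V E _ v] v by (auto simp: two_regular_def)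
      have "card (V - {v} - nbhd E v) < card V"
        using v less.prems by (intro psubset_card_mono) auto
      then obtain C where C: "cycle_cover (V - {v} - nbhd E v) (snd (remove_triangle v E)) C"
        using less.hyps R(1) less.prems by blast
      have "insert v (nbhd E v \<union> (V - {v} - nbhd E v)) = V" using sub v by auto
      moreover have "(nbhd E v, snd (remove_triangle v E)) = remove_triangle v E"
        by (simp add: remove_triangle_def)
      ultimately show ?thesis
        using cycle_cover_add_triangle[OF R(1) _ _ c _ C, of v] R(2) sub by auto
    next
      case False
      note R = two_regular_suppress[OF less.prems(2) v False]
      have "card (V - {v}) < card V"
        using v less.prems by (intro psubset_card_mono) auto
      then obtain C where C: "cycle_cover (V - {v}) (fst (suppress v E)) C"
        using less.hyps R(1) less.prems by blast
      show ?thesis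
        using cycle_cover_subdivide[OF R(1,2) _ C, of v] R(3) v by (auto simp: insert_absorb)
    qed
  qed
qed

lemma hopping_number_subdivide:
  assumes "finite V" "E \<in> two_regular V" "e \<in> E" "v \<notin> V"
  shows "hopping_number (insert v V) (subdivide v (E, e)) = hopping_number V E"
proof -
  obtain C where C: "cycle_cover V E C" using ex_cycle_cover[OF assms(1,2)] by blast
  then obtain C' where "cycle_cover (insert v V) (subdivide v (E, e)) C'" "card C' = card C"
    using cycle_cover_subdivide[OF assms(2-4)] by blast
  then show ?thesis
    using hopping_number_cycle_cover[OF assms(2) C]
      hopping_number_cycle_cover[OF two_regular_subdivide(1)[OF assms(2-4)]] by fastforce
qed

lemma hopping_number_add_triangle:
  assumes "finite V" "E \<in> two_regular V" "v \<notin> V" "v \<notin> S" "card S = 2" "S \<inter> V = {}"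
  shows "hopping_number (insert v (S \<union> V)) (add_triangle v (S, E)) = hopping_number V E + 3"
proof -
  obtain C where C: "cycle_cover V E C" using ex_cycle_cover[OF assms(1,2)] by blast
  then obtain C' where "cycle_cover (insert v (S \<union> V)) (add_triangle v (S, E)) C'"
    "card C' = Suc (card C)" using cycle_cover_add_triangle[OF assms(2-6)] by blast
  then show ?thesis
    using hopping_number_cycle_cover[OF assms(2) C]
      hopping_number_cycle_cover[OF two_regular_add_triangle(1)[OF assms(2-6)]] by fastforce
qed

section \<open>Counting 2-regular graphs by their number of cycles\<close>

text \<open>Since \<open>hopping_number\<close> is three times the number of cycles, each graph is weighted by \<open>x\<close> to
  that number.\<close>

definition weight :: "real \<Rightarrow> 'a set \<Rightarrow> real" where
  "weight x V = (\<Sum>E\<in>two_regular V. x powr (real (hopping_number V E) / 3))"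

lemma finite_two_regular: "finite V \<Longrightarrow> finite (two_regular V)"
  by (rule finite_subset[of _ "Pow (Pow V)"]) (auto simp: two_regular_def simple_graph_def)

text \<open>The graphs are split by whether \<open>v\<close> lies on a triangle. Those where it does
  not correspond to a smaller graph with a marked edge. Those where it does correspond to the other
  two corners and a graph on the rest; the extra cycle adds 3 to the hopping number, which gives the
  factor \<open>x\<close>.\<close>

lemma weight_rec:
  assumes V: "finite V" "v \<in> V" and x: "x > 0"
  shows "weight x V = real (card V - 1) * weight x (V - {v}) +
    x * (\<Sum>S | S \<subseteq> V - {v} \<and> card S = 2. weight x (V - {v} - S))"
proof -
  let ?g = "\<lambda>V E. x powr (real (hopping_number V E) / 3)"
  let ?A = "{E \<in> two_regular V. nbhd E v \<notin> E}" and ?B = "{E \<in> two_regular V. nbhd E v \<in> E}"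
  let ?T = "{S. S \<subseteq> V - {v} \<and> card S = 2}"
  have iV: "insert v (V - {v}) = V" using V by auto
  have fin: "finite (V - {v})" "v \<notin> V - {v}" using V by auto
  have "bij_betw (subdivide v) (SIGMA E:two_regular (V - {v}). E) ?A"
  proof (rule bij_betw_byWitness[where f' = "suppress v"])
    show "\<forall>p\<in>(SIGMA E:two_regular (V - {v}). E). suppress v (subdivide v p) = p"
      using suppress_subdivide[OF _ _ fin(2)] by auto
    show "\<forall>E\<in>?A. subdivide v (suppress v E) = E"
      using two_regular_suppress(3)[OF _ V(2)] by blast
    show "subdivide v ` (SIGMA E:two_regular (V - {v}). E) \<subseteq> ?A"
    proof (intro image_subsetI)
      fix p assume "p \<in> (SIGMA E:two_regular (V - {v}). E)"
      then obtain E e where E: "E \<in> two_regular (V - {v})" "e \<in> E" and p: "p = (E, e)" by auto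
      show "subdivide v p \<in> ?A"
        using two_regular_subdivide(1)[OF E fin(2)] nbhd_subdivide_notin[OF E fin(2)]
        unfolding iV p by blast
    qed
    show "suppress v ` ?A \<subseteq> (SIGMA E:two_regular (V - {v}). E)"
    proof (intro image_subsetI)
      fix E assume "E \<in> ?A"
      then have E: "E \<in> two_regular V" "nbhd E v \<notin> E" by auto
      have "(fst (suppress v E), snd (suppress v E)) \<in> (SIGMA E:two_regular (V - {v}). E)"
        using two_regular_suppress(1,2)[OF E(1) V(2) E(2)] by blast
      then show "suppress v E \<in> (SIGMA E:two_regular (V - {v}). E)" by simp
    qed
  qed
  then have "sum (?g V) ?A = (\<Sum>p\<in>(SIGMA E:two_regular (V - {v}). E). ?g V (subdivide v p))"
    by (rule sum.reindex_bij_betw[symmetric])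
  also have "\<dots> = (\<Sum>p\<in>(SIGMA E:two_regular (V - {v}). E). ?g (V - {v}) (fst p))"
    using hopping_number_subdivide[OF fin(1) _ _ fin(2)] iV by (intro sum.cong) auto
  also have "\<dots> = (\<Sum>E\<in>two_regular (V - {v}). \<Sum>e\<in>E. ?g (V - {v}) E)"
  proof (subst sum.Sigma)
    show "\<forall>E\<in>two_regular (V - {v}). finite E"
      using V by (auto simp: two_regular_def simple_graph_def intro: finite_subset[of _ "Pow V"])
  qed (use finite_two_regular[OF fin(1)] in \<open>auto simp: case_prod_beta\<close>)
  \<comment> \<open>All \<open>card V - 1\<close> choices of the marked edge carry the same
    weight.\<close>
  also have "\<dots> = real (card V - 1) * weight x (V - {v})"
    unfolding weight_def sum_distrib_left
    using card_two_regular_edges[OF _ fin(1)] V by (intro sum.cong) auto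
  finally have A: "sum (?g V) ?A = real (card V - 1) * weight x (V - {v})" .
  have iS: "insert v (S \<union> (V - {v} - S)) = V" if "S \<in> ?T" for S using that V by auto
  have "bij_betw (add_triangle v) (SIGMA S:?T. two_regular (V - {v} - S)) ?B"
  proof (rule bij_betw_byWitness[where f' = "remove_triangle v"])
    show "\<forall>p\<in>(SIGMA S:?T. two_regular (V - {v} - S)). remove_triangle v (add_triangle v p) = p"
    proof
      fix p assume "p \<in> (SIGMA S:?T. two_regular (V - {v} - S))"
      then obtain S E where S: "S \<subseteq> V - {v}" "card S = 2" and E: "E \<in> two_regular (V - {v} - S)"
        and p: "p = (S, E)" by auto
      show "remove_triangle v (add_triangle v p) = p"
        unfolding p by (rule two_regular_add_triangle(4)[OF E]) (use S in auto)
    qed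
    show "\<forall>E\<in>?B. add_triangle v (remove_triangle v E) = E"
      using two_regular_remove_triangle(2)[OF _ V(2)] by blast
    show "add_triangle v ` (SIGMA S:?T. two_regular (V - {v} - S)) \<subseteq> ?B"
    proof (intro image_subsetI)
      fix p assume "p \<in> (SIGMA S:?T. two_regular (V - {v} - S))"
      then obtain S E where S: "S \<subseteq> V - {v}" "card S = 2" and E: "E \<in> two_regular (V - {v} - S)"
        and p: "p = (S, E)" by auto
      show "add_triangle v p \<in> ?B"
      proof -
        have "v \<notin> V - {v} - S" "v \<notin> S" "S \<inter> (V - {v} - S) = {}" using S by auto
        note T = two_regular_add_triangle[OF E this(1,2) S(2) this(3)]
        have "insert v (S \<union> (V - {v} - S)) = V" using S by (intro iS) simp
        then show ?thesis using T(1,3) unfolding p by simp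
      qed
    qed
    show "remove_triangle v ` ?B \<subseteq> (SIGMA S:?T. two_regular (V - {v} - S))"
    proof (intro image_subsetI)
      fix E assume "E \<in> ?B"
      then have E: "E \<in> two_regular V" "nbhd E v \<in> E" by auto
      have "nbhd E v \<subseteq> V - {v}"
        using nbhd_simple_graph[of V E _ v] E(1) unfolding two_regular_def by blast
      moreover have "card (nbhd E v) = 2" using E V by (auto simp: two_regular_def)
      ultimately show "remove_triangle v E \<in> (SIGMA S:?T. two_regular (V - {v} - S))"
        using two_regular_remove_triangle(1)[OF E(1) V(2) E(2)] by (simp add: remove_triangle_def)
    qed
  qed
  then have "sum (?g V) ?B = (\<Sum>p\<in>(SIGMA S:?T. two_regular (V - {v} - S)). ?g V (add_triangle v p))"
    by (rule sum.reindex_bij_betw[symmetric])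
  also have "\<dots> = (\<Sum>(S, E)\<in>(SIGMA S:?T. two_regular (V - {v} - S)). x * ?g (V - {v} - S) E)"
  proof (intro sum.cong refl, clarify)
    fix S E assume S: "S \<subseteq> V - {v}" "card S = 2" and E: "E \<in> two_regular (V - {v} - S)"
    have "hopping_number V (add_triangle v (S, E)) = hopping_number (V - {v} - S) E + 3"
    proof -
      have "finite (V - {v} - S)" "v \<notin> V - {v} - S" "v \<notin> S" "S \<inter> (V - {v} - S) = {}"
        using S V by auto
      note T = hopping_number_add_triangle[OF this(1) E this(2,3) S(2) this(4)]
      have "insert v (S \<union> (V - {v} - S)) = V" using S by (intro iS) simp
      then show ?thesis using T by simp
    qed
    then show "?g V (add_triangle v (S, E)) = x * ?g (V - {v} - S) E"
      using x by (simp add: add_divide_distrib powr_add)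
  qed
  also have "\<dots> = (\<Sum>S\<in>?T. \<Sum>E\<in>two_regular (V - {v} - S). x * ?g (V - {v} - S) E)"
    by (rule sum.Sigma[symmetric]) (use V in \<open>auto intro!: finite_two_regular\<close>)
  also have "\<dots> = x * (\<Sum>S\<in>?T. weight x (V - {v} - S))"
    by (simp add: weight_def sum_distrib_left)
  finally have B: "sum (?g V) ?B = x * (\<Sum>S\<in>?T. weight x (V - {v} - S))" .
  have "weight x V = sum (?g V) (?A \<union> ?B)"
    unfolding weight_def by (intro sum.cong) auto
  also have "\<dots> = sum (?g V) ?A + sum (?g V) ?B"
    using finite_two_regular[OF V(1)] by (intro sum.union_disjoint) auto
  finally show ?thesis unfolding A B .
qed

text \<open>The initial values reflect that the empty graph is the only 2-regular graph on no
  vertices and that there is none on one or two. In the recurrence the sum over pairs of corners has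
  become a binomial coefficient.\<close>

fun cycle_weight :: "real \<Rightarrow> nat \<Rightarrow> real" where
  "cycle_weight x 0 = 1"
| "cycle_weight x (Suc 0) = 0"
| "cycle_weight x (Suc (Suc 0)) = 0"
| "cycle_weight x (Suc (Suc (Suc m))) =
     real (m + 2) * cycle_weight x (Suc (Suc m)) + x * real ((m + 2) choose 2) * cycle_weight x m"

lemma weight_empty: "weight x {} = 1" if "x > 0"
proof -
  have R: "two_regular {} = {{} :: 'a set set}"
    by (auto simp: two_regular_def simple_graph_def)
  have "cycle_cover {} {} ({} :: 'a list set)" by (simp add: cycle_cover_def)
  then have "hopping_number {} ({} :: 'a set set) = 0"
    using hopping_number_cycle_cover[of "{} :: 'a set set" "{}" "{}"] R by simp
  then show ?thesis using that by (simp add: weight_def R)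
qed

lemma weight_eq_cycle_weight:
  assumes "finite V" "x > 0"
  shows "weight x V = cycle_weight x (card V)"
  using assms(1)
proof (induction "card V" arbitrary: V rule: less_induct)
  case less
  show ?case
  proof (cases "V = {}")
    case True
    then show ?thesis using weight_empty[OF assms(2)] by simp
  next
    case False
    then obtain v where v: "v \<in> V" by blast
    let ?n = "card V"
    let ?T = "{S. S \<subseteq> V - {v} \<and> card S = 2}"
    have n: "?n > 0" and c: "card (V - {v}) = ?n - 1" using less.prems v by (auto simp: card_gt_0_iff)
    have "weight x (V - {v}) = cycle_weight x (?n - 1)"
      using less.hyps[of "V - {v}"] less.prems n c by simp
    moreover have "weight x (V - {v} - S) = cycle_weight x (?n - 3)" if S: "S \<in> ?T" for S
    proof -
      have "finite S" using S less.prems by (auto intro: finite_subset)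
      then have "card (V - {v} - S) = ?n - 3" using S c by (simp add: card_Diff_subset)
      then show ?thesis using less.hyps[of "V - {v} - S"] less.prems n by simp
    qed
    moreover have "card ?T = (?n - 1) choose 2"
      using n_subsets[of "V - {v}" 2] less.prems c by simp
    ultimately have rec: "weight x V = real (?n - 1) * cycle_weight x (?n - 1)
        + x * (real ((?n - 1) choose 2) * cycle_weight x (?n - 3))"
      unfolding weight_rec[OF less.prems v assms(2)] by simp
    \<comment> \<open>For one or two vertices the binomial coefficient is 0, so the truncated index
      \<open>?n - 3\<close> does no harm.\<close>
    consider "?n = Suc 0" | "?n = Suc (Suc 0)" | m where "?n = Suc (Suc (Suc m))"
      using n by (metis not_gr_zero old.nat.exhaust)
    then show ?thesis
      by cases (simp_all add: rec)
  qed
qed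

section \<open>Growth of the cycle weights\<close>

lemma cycle_weight_nonneg: "x > 0 \<Longrightarrow> 0 \<le> cycle_weight x n"
  by (induction x n rule: cycle_weight.induct) auto

text \<open>Normalising index \<open>n\<close> by \<open>fact (n - 1)\<close> absorbs the factor
  \<open>n - 1\<close>, and the binomial coefficient leaves only \<open>x / 2\<close>. What remains
  is a sequence with explicit increments.\<close>

lemma cycle_weight_fact_rec:
  "cycle_weight x (m + 3) / fact (m + 2) =
     cycle_weight x (m + 2) / fact (m + 1) + x / 2 * (cycle_weight x m / fact m)"
proof -
  have "2 * ((m + 2) choose 2) = (m + 2) * (m + 1)" by (simp add: choose_two)
  then have "real (2 * ((m + 2) choose 2)) = real ((m + 2) * (m + 1))" by (rule arg_cong)
  then have choose: "real ((m + 2) choose 2) = (real m + 2) * (real m + 1) / 2"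
    by (simp add: algebra_simps)
  have "m + 3 = Suc (Suc (Suc m))" "m + 2 = Suc (Suc m)" by simp_all
  then have rec: "cycle_weight x (m + 3)
      = (real m + 2) * cycle_weight x (m + 2) + x * ((real m + 2) * (real m + 1) / 2) * cycle_weight x m"
    using choose by (simp only: cycle_weight.simps) simp
  have fact: "(fact (m + 2) :: real) = (real m + 2) * ((real m + 1) * fact m)"
    "(fact (m + 1) :: real) = (real m + 1) * fact m" by (simp_all add: algebra_simps)
  \<comment> \<open>Here \<open>P\<close>, \<open>Q\<close> and \<open>f\<close> stand for
    \<open>m + 2\<close>, \<open>m + 1\<close> and \<open>fact m\<close>.\<close>
  have "(P * a + x * (P * Q / 2) * b) / (P * (Q * f)) = a / (Q * f) + x / 2 * (b / f)"
    if "0 < P" "0 < Q" "0 < f" for P Q a b f :: real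
    using that by (simp add: field_simps)
  then show ?thesis unfolding rec fact by simp
qed

text \<open>The normalised weight grows by a factor of at most \<open>1 + x / 2 / (m + 2)\<close>
  per step, and this is at most the ratio of consecutive values of the bound.\<close>

lemma cycle_weight_le:
  assumes "x > 0"
  shows "cycle_weight x (m + 4) / fact (m + 3) \<le> x / 2 * real (m + 1) powr (x / 2)"
proof -
  define S where "S n = cycle_weight x (n + 1) / fact n" for n
  have rec: "S (k + 2) = S (k + 1) + x / 2 * (cycle_weight x k / fact k)" for k
    using cycle_weight_fact_rec[of x k] by (simp add: S_def numeral_eq_Suc)
  have mono: "S (k + 1) \<le> S (k + 2)" for k
    unfolding rec using cycle_weight_nonneg[OF assms, of k] assms by simp
  have "S (m + 3) \<le> x / 2 * real (m + 1) powr (x / 2)" for m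
  proof (induction m)
    case 0
    \<comment> \<open>Both sides equal \<open>x / 2\<close>, as
      \<open>cycle_weight x 4 = 3 * x\<close> and \<open>fact 3 = 6\<close>.\<close>
    show ?case by (simp add: S_def numeral_eq_Suc)
  next
    case (Suc m)
    \<comment> \<open>the recurrence for \<open>S\<close> only increases, so the delayed term may be replaced by the newest one\<close>
    have "cycle_weight x (m + 2) / fact (m + 2) = S (m + 1) / real (m + 2)"
      by (simp add: S_def divide_divide_eq_left mult.commute)
    also have "\<dots> \<le> S (m + 3) / real (m + 2)"
      using mono[of m] mono[of "m + 1"] by (intro divide_right_mono) (simp_all add: numeral_eq_Suc)
    finally have "x / 2 * (cycle_weight x (m + 2) / fact (m + 2)) \<le> x / 2 * (S (m + 3) / real (m + 2))"
      using assms by (intro mult_left_mono) auto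
    then have "S (m + 4) \<le> S (m + 3) + x / 2 * (S (m + 3) / real (m + 2))"
      using rec[of "m + 2"] by (simp add: numeral_eq_Suc)
    also have "\<dots> = S (m + 3) * (1 + x / 2 / real (m + 2))"
      by (simp add: distrib_left)
    also have "\<dots> \<le> (x / 2 * real (m + 1) powr (x / 2)) * (real (m + 2) / real (m + 1)) powr (x / 2)"
    proof (intro mult_mono Suc.IH)
      \<comment> \<open>This is \<open>ln u \<le> u - 1\<close> at
        \<open>u = (m + 1) / (m + 2)\<close>. Multiplied by \<open>x / 2\<close> and exponentiated,
        it bounds the growth factor.\<close>
      have "1 / real (m + 2) \<le> ln (real (m + 2) / real (m + 1))"
      proof -
        have "ln (real (m + 1) / real (m + 2)) \<le> real (m + 1) / real (m + 2) - 1"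
          by (rule ln_le_minus_one) simp
        also have "\<dots> = - (1 / real (m + 2))" by (simp add: field_simps)
        finally show ?thesis by (simp add: ln_div)
      qed
      then have "x / 2 * (1 / real (m + 2)) \<le> x / 2 * ln (real (m + 2) / real (m + 1))"
        using assms by (intro mult_left_mono) auto
      then have "exp (x / 2 / real (m + 2)) \<le> (real (m + 2) / real (m + 1)) powr (x / 2)"
        by (simp add: powr_def)
      then show "1 + x / 2 / real (m + 2) \<le> (real (m + 2) / real (m + 1)) powr (x / 2)"
        using exp_ge_add_one_self order_trans by blast
    qed (use assms in auto)
    also have "\<dots> = x / 2 * real (m + 2) powr (x / 2)"
      by (simp add: powr_divide)
    finally show ?case by (simp add: numeral_eq_Suc)
  qed
  from this[of m] show ?thesis by (simp add: S_def numeral_eq_Suc)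
qed

text \<open>By induction the increment is at least \<open>1 / (10 * sqrt m)\<close>, which covers
  the growth of \<open>sqrt n / 5\<close> from \<open>m + 2\<close> to \<open>m + 3\<close>. The 5
  comes from the base cases.\<close>

lemma cycle_weight_1_ge:
  assumes "n \<ge> 3"
  shows "sqrt (real n) / 5 \<le> cycle_weight 1 n / fact (n - 1)"
  using assms
proof (induction n rule: less_induct)
  case (less n)
  \<comment> \<open>The step refers back to \<open>n - 3\<close>, which must itself be at least 3.
    At 3, 4 and 5 the normalised weight is \<open>1 / 2\<close>, and
    \<open>sqrt 5 \<le> 5 / 2\<close>.\<close>
  consider "n = 3" | "n = 4" | "n = 5" | m where "n = m + 3" "m \<ge> 3"
  proof (cases "n < 6")
    case True
    then have "n = 3 \<or> n = 4 \<or> n = 5" using less.prems by linarith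
    then show ?thesis using that by blast
  next
    case False
    then show ?thesis using that(4)[of "n - 3"] by simp
  qed
  then show ?case
  proof cases
    case 1
    have "sqrt 3 \<le> 5 / 2" by (rule real_le_lsqrt) (auto simp: power2_eq_square)
    then show ?thesis unfolding 1 by (simp add: eval_nat_numeral)
  next
    case 2
    have "sqrt 4 \<le> 5 / 2" by (rule real_le_lsqrt) (auto simp: power2_eq_square)
    then show ?thesis unfolding 2 by (simp add: eval_nat_numeral)
  next
    case 3
    have "sqrt 5 \<le> 5 / 2" by (rule real_le_lsqrt) (auto simp: power2_eq_square)
    then show ?thesis unfolding 3 by (simp add: eval_nat_numeral)
  next
    case (4 m)
    have m: "real m > 0" using 4 by simp
    \<comment> \<open>The tangent at \<open>m + 2\<close> lies above the concave square
      root.\<close>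
    have "sqrt (real (m + 3)) \<le> sqrt (real (m + 2)) + 1 / (2 * sqrt (real (m + 2)))"
    proof (rule real_le_lsqrt)
      have "(sqrt (real (m + 2)) + 1 / (2 * sqrt (real (m + 2))))\<^sup>2
          = real (m + 2) + 1 + (1 / (2 * sqrt (real (m + 2))))\<^sup>2"
        by (simp add: power2_sum)
      then show "real (m + 3) \<le> (sqrt (real (m + 2)) + 1 / (2 * sqrt (real (m + 2))))\<^sup>2" by simp
    qed simp
    also have "1 / (2 * sqrt (real (m + 2))) \<le> 1 / (2 * sqrt (real m))"
      using m by (intro divide_left_mono) auto
    finally have "sqrt (real (m + 3)) \<le> sqrt (real (m + 2)) + 1 / (2 * sqrt (real m))" by simp
    note le = this
    have "sqrt (real (m + 3)) / 5 \<le> sqrt (real (m + 2)) / 5 + 1 / 2 * (sqrt (real m) / 5 / real m)"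
    proof -
      have "sqrt (real m) / real m = 1 / sqrt (real m)" using m by (simp add: field_simps)
      moreover have "sqrt (real m) / 5 / real m = sqrt (real m) / real m / 5" by simp
      ultimately have "1 / 2 * (sqrt (real m) / 5 / real m) = 1 / (2 * sqrt (real m)) / 5" by simp
      then show ?thesis using divide_right_mono[OF le, of 5] by (simp only: add_divide_distrib)
    qed
    also have "\<dots> \<le> cycle_weight 1 (m + 2) / fact (m + 1) + 1 / 2 * (cycle_weight 1 m / fact m)"
    proof (intro add_mono mult_left_mono)
      show "sqrt (real (m + 2)) / 5 \<le> cycle_weight 1 (m + 2) / fact (m + 1)"
        using less.IH[of "m + 2"] 4 by simp
      have "fact m = real m * fact (m - 1)" using 4 by (intro fact_reduce) auto
      moreover have "sqrt (real m) / 5 / real m \<le> cycle_weight 1 m / fact (m - 1) / real m"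
        using less.IH[of m] 4 by (intro divide_right_mono) auto
      ultimately show "sqrt (real m) / 5 / real m \<le> cycle_weight 1 m / fact m"
        by (simp add: mult.commute)
    qed simp
    also have "\<dots> = cycle_weight 1 (m + 3) / fact (m + 2)"
      by (rule cycle_weight_fact_rec[symmetric])
    finally show ?thesis unfolding 4 by simp
  qed
qed

text \<open>As \<open>cycle_weight 1 n\<close> is the number of graphs, the ratio is the probability
  generating function of the number of cycles at \<open>x\<close>. The constant combines
  \<open>x / 2\<close> from the upper bound with 5 from the lower one.\<close>

lemma cycle_weight_ratio_le:
  assumes "x > 0" "n \<ge> 4"
  shows "cycle_weight x n / cycle_weight 1 n \<le> 5 * x / 2 * real n powr ((x - 1) / 2)"
proof -
  obtain m where m: "n = m + 4" using assms(2) by (metis add.commute le_Suc_ex)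
  let ?A = "cycle_weight x n / fact (n - 1)" and ?B = "cycle_weight 1 n / fact (n - 1)"
  have "?A \<le> x / 2 * real (m + 1) powr (x / 2)"
    using cycle_weight_le[OF assms(1), of m] unfolding m by (simp del: fact_Suc add: add.commute)
  also have "\<dots> \<le> x / 2 * real n powr (x / 2)"
    using assms(1) m by (intro mult_left_mono powr_mono2) auto
  finally have A: "?A \<le> x / 2 * real n powr (x / 2)" .
  have B: "real n powr (1 / 2) / 5 \<le> ?B"
    using cycle_weight_1_ge[of n] assms(2) by (simp add: powr_half_sqrt)
  have "cycle_weight x n / cycle_weight 1 n = ?A / ?B" by simp
  also have "\<dots> \<le> (x / 2 * real n powr (x / 2)) / (real n powr (1 / 2) / 5)"
    by (rule frac_le[OF _ A _ B]) (use assms in auto)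
  also have "\<dots> = 5 * x / 2 * (real n powr (x / 2) / real n powr (1 / 2))" by simp
  also have "real n powr (x / 2) / real n powr (1 / 2) = real n powr ((x - 1) / 2)"
    by (simp add: powr_diff[symmetric] diff_divide_distrib)
  finally show ?thesis .
qed

section \<open>Concentration\<close>

text \<open>Chernoff bound at the threshold \<open>t * ln n / 2\<close> for the number of cycles.
  Stating the event with powers of \<open>t\<close> covers both tails: the upper one for
  \<open>t > 1\<close>, the lower one for \<open>t < 1\<close>. Using the same \<open>t\<close> as
  base and as multiplier minimises the exponent.\<close>

lemma prob_hopping_number_tail:
  assumes t: "t > 0" and n: "n \<ge> 4"
  shows "measure_pmf.prob (random_regular_graph n 2)
      {E. t powr (t * ln (real n) / 2) \<le> t powr (real (hopping_number {..<n} E) / 3)}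
    \<le> 5 * t / 2 * real n powr ((t - 1 - t * ln t) / 2)"
proof -
  let ?R = "two_regular {..<n}" and ?c = "t powr (t * ln (real n) / 2)"
  let ?g = "\<lambda>E. t powr (real (hopping_number {..<n} E) / 3)"
  have fin: "finite ?R" by (rule finite_two_regular) simp
  have "real (card ?R) = weight 1 {..<n}" by (simp add: weight_def)
  then have card: "real (card ?R) = cycle_weight 1 n" by (simp add: weight_eq_cycle_weight)
  \<comment> \<open>A positive count means that graphs exist, so \<open>pmf_of_set\<close> is the
    uniform distribution on them.\<close>
  have "0 < sqrt (real n) / 5" using n by simp
  also have "\<dots> \<le> cycle_weight 1 n / fact (n - 1)" using n by (intro cycle_weight_1_ge) simp
  finally have pos: "cycle_weight 1 n > 0" by (simp add: zero_less_divide_iff)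
  then have ne: "?R \<noteq> {}" using card by auto
  have c: "?c = real n powr (t * ln t / 2)" using t n by (simp add: powr_def mult_ac)
  then have cpos: "?c > 0" using n by simp
  \<comment> \<open>Markov's inequality, in counting form.\<close>
  have "real (card (?R \<inter> {E. ?c \<le> ?g E})) * ?c = (\<Sum>E\<in>?R \<inter> {E. ?c \<le> ?g E}. ?c)" by simp
  also have "\<dots> \<le> (\<Sum>E\<in>?R \<inter> {E. ?c \<le> ?g E}. ?g E)" by (intro sum_mono) auto
  also have "\<dots> \<le> sum ?g ?R" using fin by (intro sum_mono2) auto
  also have "\<dots> = cycle_weight t n"
    using weight_eq_cycle_weight[of "{..<n}" t] t by (simp add: weight_def)
  finally have "real (card (?R \<inter> {E. ?c \<le> ?g E})) \<le> cycle_weight t n / ?c"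
    using cpos by (simp add: pos_le_divide_eq)
  then have "real (card (?R \<inter> {E. ?c \<le> ?g E})) / real (card ?R) \<le> cycle_weight t n / ?c / cycle_weight 1 n"
    unfolding card using pos by (intro divide_right_mono) auto
  also have "\<dots> = cycle_weight t n / cycle_weight 1 n / ?c" by simp
  also have "\<dots> \<le> 5 * t / 2 * real n powr ((t - 1) / 2) / ?c"
    using cpos by (intro divide_right_mono cycle_weight_ratio_le t n) auto
  also have "\<dots> = 5 * t / 2 * (real n powr ((t - 1) / 2) / real n powr (t * ln t / 2))"
    unfolding c by simp
  also have "real n powr ((t - 1) / 2) / real n powr (t * ln t / 2) = real n powr ((t - 1 - t * ln t) / 2)"
    by (simp add: powr_diff[symmetric] diff_divide_distrib)
  finally show ?thesis
    using fin ne by (simp add: random_regular_graph_def regular_graphs_2 measure_pmf_of_set)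
qed

text \<open>The strict form of \<open>ln u \<le> u - 1\<close> at \<open>u = 1 / t\<close>,
  multiplied by \<open>t\<close>.\<close>

lemma tail_exponent_neg:
  assumes "t > 0" "t \<noteq> (1::real)"
  shows "t - 1 - t * ln t < 0"
proof -
  have "ln (1 / t) \<noteq> 1 / t - 1" using ln_eq_minus_one[of "1 / t"] assms by auto
  then have "ln (1 / t) < 1 / t - 1" using ln_le_minus_one[of "1 / t"] assms by simp
  then have "t * (- ln t) < t * (1 / t - 1)"
    using assms by (intro mult_strict_left_mono) (simp_all add: ln_div)
  then show ?thesis using assms by (simp add: algebra_simps)
qed

lemma tail_tendsto_0:
  assumes "t > 0" "t \<noteq> (1::real)"
  shows "(\<lambda>n. 5 * t / 2 * real n powr ((t - 1 - t * ln t) / 2)) \<longlonglongrightarrow> 0"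
proof -
  have "(\<lambda>n. real n powr ((t - 1 - t * ln t) / 2)) \<longlonglongrightarrow> 0"
    using tail_exponent_neg[OF assms]
    by (intro tendsto_neg_powr filterlim_real_sequentially) auto
  from tendsto_mult_left[OF this, of "5 * t / 2"] show ?thesis by simp
qed

text \<open>Failure means too many or too few cycles, that is, the tail events for
  \<open>t = 1 + \<epsilon>\<close> and \<open>t = 1 - \<epsilon>\<close>;
  \<open>\<epsilon> < 1\<close> keeps the second base positive.\<close>

lemma hopping_number_concentration:
  assumes "0 < \<epsilon>" "\<epsilon> < 1"
  shows "aas (\<lambda>n. random_regular_graph n 2)
    (\<lambda>n E. \<bar>real (hopping_number {..<n} E) - 3 / 2 * ln (real n)\<bar> \<le> \<epsilon> * (3 / 2 * ln (real n)))"
  unfolding aas_def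
proof (rule tendsto_sandwich)
  let ?p = "\<lambda>n. random_regular_graph n 2"
  let ?good = "\<lambda>n. {E. \<bar>real (hopping_number {..<n} E) - 3 / 2 * ln (real n)\<bar> \<le> \<epsilon> * (3 / 2 * ln (real n))}"
  let ?tail = "\<lambda>t n. 5 * t / 2 * real n powr ((t - 1 - t * ln t) / 2)"
  let ?A = "\<lambda>t n. {E. t powr (t * ln (real n) / 2) \<le> t powr (real (hopping_number {..<n} E) / 3)}"
  let ?l = "\<lambda>n. 1 - (?tail (1 + \<epsilon>) n + ?tail (1 - \<epsilon>) n)"
  have "?l \<longlonglongrightarrow> 1 - (0 + 0)"
    using assms by (intro tendsto_intros tail_tendsto_0) auto
  then show "?l \<longlonglongrightarrow> 1" by simp
  show "\<forall>\<^sub>F n in sequentially. ?l n \<le> measure_pmf.prob (?p n) (?good n)"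
  proof (rule eventually_sequentiallyI[of 4])
    fix n :: nat assume n: "4 \<le> n"
    have "- ?good n \<subseteq> ?A (1 + \<epsilon>) n \<union> ?A (1 - \<epsilon>) n"
    proof
      fix E assume "E \<in> - ?good n"
      then consider "real (hopping_number {..<n} E) > 3 / 2 * ln (real n) + \<epsilon> * (3 / 2 * ln (real n))"
        | "real (hopping_number {..<n} E) < 3 / 2 * ln (real n) - \<epsilon> * (3 / 2 * ln (real n))"
        by (auto simp: abs_le_iff not_le) argo
      then show "E \<in> ?A (1 + \<epsilon>) n \<union> ?A (1 - \<epsilon>) n"
      proof cases
        case 1
        then have "(1 + \<epsilon>) * ln (real n) / 2 \<le> real (hopping_number {..<n} E) / 3"
          by (simp add: field_simps)
        then have "E \<in> ?A (1 + \<epsilon>) n" using assms by simp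
        then show ?thesis by blast
      next
        case 2
        then have "real (hopping_number {..<n} E) / 3 \<le> (1 - \<epsilon>) * ln (real n) / 2"
          by (simp add: field_simps)
        \<comment> \<open>A base below 1 reverses the order, so few cycles give a large
          power.\<close>
        then have "E \<in> ?A (1 - \<epsilon>) n" using assms by (simp add: powr_mono')
        then show ?thesis by blast
      qed
    qed
    then have "measure_pmf.prob (?p n) (- ?good n) \<le> measure_pmf.prob (?p n) (?A (1 + \<epsilon>) n \<union> ?A (1 - \<epsilon>) n)"
      by (intro measure_pmf.finite_measure_mono) auto
    also have "\<dots> \<le> measure_pmf.prob (?p n) (?A (1 + \<epsilon>) n) + measure_pmf.prob (?p n) (?A (1 - \<epsilon>) n)"
      by (intro measure_Un_le) auto
    also have "\<dots> \<le> ?tail (1 + \<epsilon>) n + ?tail (1 - \<epsilon>) n"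
      using assms n by (intro add_mono prob_hopping_number_tail) auto
    finally show "?l n \<le> measure_pmf.prob (?p n) (?good n)"
      using measure_pmf.prob_compl[of "?good n" "?p n"] by (simp add: Compl_eq_Diff_UNIV)
  qed
qed auto

text \<open>\<open>\<delta> n\<close> is essentially the least \<epsilon> for which
  \<open>P \<epsilon> n\<close> fails with probability at most \<epsilon>. Every fixed \<epsilon>
  between 0 and 1 qualifies from some \<open>n\<close> on, so \<open>\<delta>\<close> tends to 0,
  and with it the failure probability. The summand \<open>1 / Suc n\<close> makes up for an infimum
  that may not be attained.\<close>

lemma aas_diagonal:
  assumes mono: "\<And>\<epsilon> \<epsilon>' n x. \<epsilon> \<le> \<epsilon>' \<Longrightarrow> P \<epsilon> n x \<Longrightarrow> P \<epsilon>' n x"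
    and aas: "\<And>\<epsilon>::real. 0 < \<epsilon> \<Longrightarrow> \<epsilon> < 1 \<Longrightarrow> aas p (P \<epsilon>)"
  shows "\<exists>\<delta>. \<delta> \<longlonglongrightarrow> 0 \<and> aas p (\<lambda>n. P (\<delta> n) n)"
proof -
  define q where "q \<epsilon> n = measure_pmf.prob (p n) {x. P \<epsilon> n x}" for \<epsilon> n
  define G where "G n = {\<epsilon>. 0 < \<epsilon> \<and> 1 - \<epsilon> \<le> q \<epsilon> n}" for n
  define \<delta> where "\<delta> n = Inf (G n) + 1 / real (Suc n)" for n
  have q_mono: "q \<epsilon> n \<le> q \<epsilon>' n" if "\<epsilon> \<le> \<epsilon>'" for \<epsilon> \<epsilon>' n
    unfolding q_def using mono[OF that] by (intro measure_pmf.finite_measure_mono) auto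
  have G1: "1 \<in> G n" for n unfolding G_def q_def by simp
  have bdd: "bdd_below (G n)" for n by (rule bdd_belowI[of _ 0]) (simp add: G_def)
  have Inf0: "0 \<le> Inf (G n)" for n
  proof (rule cInf_greatest)
    show "G n \<noteq> {}" using G1 by blast
  qed (simp add: G_def)
  have \<delta>_G: "1 - \<delta> n \<le> q (\<delta> n) n" for n
  proof -
    have "Inf (G n) < \<delta> n" by (simp add: \<delta>_def)
    then obtain g where g: "g \<in> G n" "g < \<delta> n" using G1 cInf_lessD[of "G n"] by blast
    then have "1 - \<delta> n \<le> q g n" by (simp add: G_def)
    also have "\<dots> \<le> q (\<delta> n) n" using g by (intro q_mono) simp
    finally show ?thesis .
  qed
  have "(\<lambda>n. Inf (G n)) \<longlonglongrightarrow> 0"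
  proof (rule order_tendstoI)
    fix e :: real assume "e > 0"
    \<comment> \<open>The cap \<open>1 / 2\<close> keeps \<epsilon> in the range where the
      convergence is assumed.\<close>
    define \<epsilon> where "\<epsilon> = min (e / 2) (1 / 2)"
    have \<epsilon>: "0 < \<epsilon>" "\<epsilon> < 1" "\<epsilon> < e" using \<open>e > 0\<close> by (auto simp: \<epsilon>_def)
    have "q \<epsilon> \<longlonglongrightarrow> 1" using aas[OF \<epsilon>(1,2)] by (simp add: aas_def q_def[abs_def])
    then have "\<forall>\<^sub>F n in sequentially. 1 - \<epsilon> < q \<epsilon> n"
      using \<epsilon> by (intro order_tendstoD) auto
    then show "\<forall>\<^sub>F n in sequentially. Inf (G n) < e"
    proof eventually_elim
      case (elim n)
      then have "\<epsilon> \<in> G n" using \<epsilon> by (simp add: G_def)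
      then have "Inf (G n) \<le> \<epsilon>" using bdd by (rule cInf_lower)
      then show ?case using \<epsilon> by simp
    qed
  next
    fix e :: real assume "e < 0"
    then have "\<forall>n. e < Inf (G n)" using Inf0 less_le_trans by blast
    then show "\<forall>\<^sub>F n in sequentially. e < Inf (G n)" by simp
  qed
  from tendsto_add[OF this lim_inverse_n'[THEN LIMSEQ_Suc]]
  have \<delta>: "\<delta> \<longlonglongrightarrow> 0" by (simp add: \<delta>_def[abs_def])
  have "(\<lambda>n. q (\<delta> n) n) \<longlonglongrightarrow> 1"
  proof (rule tendsto_sandwich)
    show "(\<lambda>n. 1 - \<delta> n) \<longlonglongrightarrow> 1" using tendsto_diff[OF tendsto_const \<delta>, of 1] by simp
  qed (use \<delta>_G in \<open>auto simp: q_def\<close>)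
  then show ?thesis using \<delta> by (auto simp: aas_def q_def)
qed

theorem theorem1p1:
  "\<exists>\<delta> :: nat \<Rightarrow> real. \<delta> \<longlonglongrightarrow> 0 \<and>
     aas (\<lambda>n. random_regular_graph n 2)
       (\<lambda>n E. \<bar>real (hopping_number {..<n} E) - 3 / 2 * ln (real n)\<bar>
                \<le> \<delta> n * (3 / 2 * ln (real n)))"
proof (rule aas_diagonal)
  fix \<epsilon> \<epsilon>' :: real and n :: nat and E :: "nat set set"
  assume "\<epsilon> \<le> \<epsilon>'"
  \<comment> \<open>For \<open>n = 0\<close> the logarithm has the default value 0, so the error
    bound is monotone in \<epsilon> for every \<open>n\<close>.\<close>
  moreover have "0 \<le> 3 / 2 * ln (real n)" by (cases n) auto
  ultimately have "\<epsilon> * (3 / 2 * ln (real n)) \<le> \<epsilon>' * (3 / 2 * ln (real n))"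
    by (rule mult_right_mono)
  then show "\<bar>real (hopping_number {..<n} E) - 3 / 2 * ln (real n)\<bar> \<le> \<epsilon>' * (3 / 2 * ln (real n))"
    if "\<bar>real (hopping_number {..<n} E) - 3 / 2 * ln (real n)\<bar> \<le> \<epsilon> * (3 / 2 * ln (real n))"
    using that by simp
qed (rule hopping_number_concentration)

end
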